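(* Let $(X,d_\phi)$ be a $\phi$-metric space and let $T:X\to X$ be a mapping satisfying $d_\phi(Tx,Ty)<d_\phi(x,y)$ for all $x,y\in X$ with $x\ne y$. If there exists $x\in X$ such that the sequence $\{T^n x\}$ has a subsequence converging to some $\zeta\in X$, then $\zeta$ is the unique fixed point of $T$.
   Context: Definition ($\phi$-metric space). Let $X$ be a nonempty set. A function $d_\phi:X\times X\to\mathbb{R}_{\ge 0}$ is a $\phi$-metric, and $(X,d_\phi)$ is a $\phi$-metric space, if there is a function $\phi:X\times X\times X\to\mathbb{R}_{\ge 0}$ such that for all $x,y,z\in X$: (d1) $d_\phi(x,y)=0$ if and only if $x=y$; (d2) $d_\phi(x,y)=d_\phi(y,x)$; (d3) $d_\phi(x,y)\le d_\phi(x,z)+d_\phi(z,y)+\phi(x,y,z)$; where $\phi$ satisfies: ($\phi1$) $\phi(x,y,z)=0$ if $x=z$ or $y=z$; ($\phi2$) $\phi(x,y,z)=\phi(y,x,z)$; ($\phi3$) for every $\epsilon>0$ there exists $\delta>0$ such that for all $x,y,z\in X$, $\phi(x,y,z)<\epsilon$ whenever $d_\phi(x,z)<\delta$ or $d_\phi(y,z)<\delta$. A sequence $\{x_n\}$ in $X$ converges to $x\in X$ if $d_\phi(x_n,x)\to 0$ as $n\to\infty$. $T^n$ denotes the $n$-fold iterate of $T$. *)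

theory Defs
  imports Complex_Main "HOL-Library.FuncSet"
begin

text \<open>
  The maps \<open>d\<close> and \<open>\<phi>\<close> are total and curried; all conditions, including nonnegativity
  (that is, codomain the nonnegative reals), are imposed on the carrier \<open>X\<close> only.
\<close>

definition control_function ::
  "'a set \<Rightarrow> ('a \<Rightarrow> 'a \<Rightarrow> real) \<Rightarrow> ('a \<Rightarrow> 'a \<Rightarrow> 'a \<Rightarrow> real) \<Rightarrow> bool" where
  "control_function X d \<phi> \<longleftrightarrow>
     (\<forall>x\<in>X. \<forall>y\<in>X. \<forall>z\<in>X. 0 \<le> \<phi> x y z) \<and>
     (\<forall>x\<in>X. \<forall>y\<in>X. \<forall>z\<in>X. x = z \<or> y = z \<longrightarrow> \<phi> x y z = 0) \<and>
     (\<forall>x\<in>X. \<forall>y\<in>X. \<forall>z\<in>X. \<phi> x y z = \<phi> y x z) \<and>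
     (\<forall>\<epsilon>>0. \<exists>\<delta>>0. \<forall>x\<in>X. \<forall>y\<in>X. \<forall>z\<in>X.
        d x z < \<delta> \<or> d y z < \<delta> \<longrightarrow> \<phi> x y z < \<epsilon>)"

definition phi_metric_space :: "'a set \<Rightarrow> ('a \<Rightarrow> 'a \<Rightarrow> real) \<Rightarrow> bool" where
  "phi_metric_space X d \<longleftrightarrow>
     X \<noteq> {} \<and>
     (\<forall>x\<in>X. \<forall>y\<in>X. 0 \<le> d x y) \<and>
     (\<exists>\<phi>. control_function X d \<phi> \<and>
        (\<forall>x\<in>X. \<forall>y\<in>X. d x y = 0 \<longleftrightarrow> x = y) \<and>
        (\<forall>x\<in>X. \<forall>y\<in>X. d x y = d y x) \<and>
        (\<forall>x\<in>X. \<forall>y\<in>X. \<forall>z\<in>X. d x y \<le> d x z + d z y + \<phi> x y z))"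

definition phi_converges_to ::
  "'a set \<Rightarrow> ('a \<Rightarrow> 'a \<Rightarrow> real) \<Rightarrow> (nat \<Rightarrow> 'a) \<Rightarrow> 'a \<Rightarrow> bool" where
  "phi_converges_to X d s x \<longleftrightarrow> (\<forall>n. s n \<in> X) \<and> x \<in> X \<and> (\<lambda>n. d (s n) x) \<longlonglongrightarrow> 0"

end

theory Submission
  imports Defs
begin

text \<open>
  A \<open>\<phi>\<close>-metric is jointly continuous along convergent sequences, because the error terms
  \<open>\<phi>\<close> vanish together with the distances. The numbers \<open>d (T\<^sup>n x) (T\<^sup>n\<^sup>+\<^sup>1 x)\<close>
  decrease, hence converge; along the given subsequence and its shift by one they converge to
  \<open>d \<zeta> (T \<zeta>)\<close> and to \<open>d (T \<zeta>) (T (T \<zeta>))\<close>. These are therefore equal, which is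
  impossible unless \<open>T \<zeta> = \<zeta>\<close>.
\<close>

text \<open>The \<open>\<delta>\<close> in the smallness condition on \<open>\<phi>\<close> is
  uniform over all points of \<open>X\<close>. Hence \<open>s\<close> and \<open>w\<close> need not
  converge, only approach each other, and the middle sequence \<open>t\<close> is arbitrary.\<close>

lemma control_function_tendsto_zero:
  assumes cf: "control_function X d \<phi>"
    and nn: "\<forall>x\<in>X. \<forall>y\<in>X. 0 \<le> d x y"
    and X: "\<And>n. s n \<in> X" "\<And>n. t n \<in> X" "\<And>n. w n \<in> X"
    and lim: "(\<lambda>n. d (s n) (w n)) \<longlonglongrightarrow> 0"
  shows "(\<lambda>n. \<phi> (s n) (t n) (w n)) \<longlonglongrightarrow> 0"
proof (rule LIMSEQ_I)
  fix e :: real assume "0 < e"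
  moreover have "\<forall>\<epsilon>>0. \<exists>\<delta>>0. \<forall>x\<in>X. \<forall>y\<in>X. \<forall>z\<in>X.
      d x z < \<delta> \<or> d y z < \<delta> \<longrightarrow> \<phi> x y z < \<epsilon>"
    using cf unfolding control_function_def by (elim conjE)
  ultimately obtain \<delta> where \<delta>: "\<delta> > 0"
    "\<forall>x\<in>X. \<forall>y\<in>X. \<forall>z\<in>X. d x z < \<delta> \<or> d y z < \<delta> \<longrightarrow> \<phi> x y z < e"
    by blast
  from LIMSEQ_D[OF lim \<delta>(1)] obtain N where "\<forall>n\<ge>N. norm (d (s n) (w n) - 0) < \<delta>"
    by blast
  moreover have "0 \<le> d (s n) (w n)" for n using nn X by blast
  moreover have "\<forall>x\<in>X. \<forall>y\<in>X. \<forall>z\<in>X. 0 \<le> \<phi> x y z"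
    using cf unfolding control_function_def by (elim conjE)
  then have "0 \<le> \<phi> (s n) (t n) (w n)" for n using X by blast
  ultimately have "\<forall>n\<ge>N. norm (\<phi> (s n) (t n) (w n) - 0) < e"
    using \<delta>(2) X by simp
  then show "\<exists>N. \<forall>n\<ge>N. norm (\<phi> (s n) (t n) (w n) - 0) < e" ..
qed

lemma phi_metric_tendsto:
  assumes ms: "phi_metric_space X d"
    and s: "phi_converges_to X d s u" and t: "phi_converges_to X d t v"
  shows "(\<lambda>n. d (s n) (t n)) \<longlonglongrightarrow> d u v"
proof -
  from ms obtain \<phi> where nn: "\<forall>x\<in>X. \<forall>y\<in>X. 0 \<le> d x y"
    and cf: "control_function X d \<phi>"
    and sym: "\<forall>x\<in>X. \<forall>y\<in>X. d x y = d y x"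
    and tri: "\<forall>x\<in>X. \<forall>y\<in>X. \<forall>z\<in>X. d x y \<le> d x z + d z y + \<phi> x y z"
    unfolding phi_metric_space_def by (elim conjE exE) (rule that)
  have X: "\<And>n. s n \<in> X" "\<And>n. t n \<in> X" "u \<in> X" "v \<in> X"
    and su: "(\<lambda>n. d (s n) u) \<longlonglongrightarrow> 0" and tv: "(\<lambda>n. d (t n) v) \<longlonglongrightarrow> 0"
    using s t unfolding phi_converges_to_def by auto
  have flip: "d (s n) u = d u (s n)" "d (t n) v = d v (t n)" for n
    using sym X by blast+
  have us: "(\<lambda>n. d u (s n)) \<longlonglongrightarrow> 0" and vt: "(\<lambda>n. d v (t n)) \<longlonglongrightarrow> 0"
    using su tv unfolding flip .
  have \<phi>sym: "\<forall>x\<in>X. \<forall>y\<in>X. \<forall>z\<in>X. \<phi> x y z = \<phi> y x z"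
    using cf unfolding control_function_def by (elim conjE)
  have \<phi>nn: "\<forall>x\<in>X. \<forall>y\<in>X. \<forall>z\<in>X. 0 \<le> \<phi> x y z"
    using cf unfolding control_function_def by (elim conjE)
  \<comment> \<open>The first pair of \<open>\<phi>\<close>-terms bounds
    \<open>d (s n) (t n) - d u v\<close>, the second pair its negative; all terms being nonnegative,
    the sum \<open>E n\<close> bounds the absolute value. Each \<open>\<phi>\<close> is oriented so
    that its first and third arguments are the ones that approach each other, as the previous lemma
    requires.\<close>
  define E where "E n = d (s n) u + d (t n) v + (\<phi> (s n) (t n) u + \<phi> (t n) u v)
    + (\<phi> u v (s n) + \<phi> v (s n) (t n))" for n
  note \<phi>0 = control_function_tendsto_zero[OF cf nn]
  have "E \<longlonglongrightarrow> 0 + 0 + (0 + 0) + (0 + 0)"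
    unfolding E_def by (intro tendsto_add su tv \<phi>0) (use X su tv us vt in auto)
  then have E0: "E \<longlonglongrightarrow> 0" by simp
  have "norm (d (s n) (t n) - d u v) \<le> E n" for n
  proof -
    \<comment> \<open>Two detours, each split into two triangle inequalities: from
      \<open>s n\<close> to \<open>t n\<close> via \<open>u\<close> and \<open>v\<close>, and from
      \<open>u\<close> to \<open>v\<close> via \<open>s n\<close> and \<open>t n\<close>.\<close>
    have "d (s n) (t n) \<le> d (s n) u + d u (t n) + \<phi> (s n) (t n) u"
      "d u (t n) \<le> d u v + d v (t n) + \<phi> u (t n) v"
      "d u v \<le> d u (s n) + d (s n) v + \<phi> u v (s n)"
      "d (s n) v \<le> d (s n) (t n) + d (t n) v + \<phi> (s n) v (t n)"
      using tri X by blast+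
    moreover have "\<phi> u (t n) v = \<phi> (t n) u v" "\<phi> (s n) v (t n) = \<phi> v (s n) (t n)"
      using \<phi>sym X by blast+
    moreover have "0 \<le> \<phi> (s n) (t n) u" "0 \<le> \<phi> (t n) u v"
      "0 \<le> \<phi> u v (s n)" "0 \<le> \<phi> v (s n) (t n)"
      using \<phi>nn X by blast+
    ultimately show ?thesis using flip[of n] unfolding E_def real_norm_def by linarith
  qed
  then have "(\<lambda>n. d (s n) (t n) - d u v) \<longlonglongrightarrow> 0"
    by (intro tendsto_norm_zero_cancel[OF tendsto_sandwich[OF _ _ tendsto_const E0]]) auto
  then show ?thesis by (simp add: LIM_zero_iff)
qed

text \<open>Squeeze the distances of the images between 0 and the original distances. The non-strict
  bound is what fits here, since \<open>s n = u\<close> may occur.\<close>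

lemma nonexpansive_phi_converges_to:
  assumes nn: "\<forall>x\<in>X. \<forall>y\<in>X. 0 \<le> d x y"
    and T: "T \<in> X \<rightarrow> X"
    and le: "\<forall>x\<in>X. \<forall>y\<in>X. d (T x) (T y) \<le> d x y"
    and s: "phi_converges_to X d s u"
  shows "phi_converges_to X d (\<lambda>n. T (s n)) (T u)"
proof -
  have X: "\<And>n. s n \<in> X" "u \<in> X" and lim: "(\<lambda>n. d (s n) u) \<longlonglongrightarrow> 0"
    using s unfolding phi_converges_to_def by auto
  have TX: "\<And>n. T (s n) \<in> X" "T u \<in> X" using T X by auto
  have "(\<lambda>n. d (T (s n)) (T u)) \<longlonglongrightarrow> 0"
    by (rule tendsto_sandwich[OF _ _ tendsto_const lim]) (simp_all add: nn le TX X)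
  then show ?thesis using TX unfolding phi_converges_to_def by blast
qed

theorem theorem5p6:
  fixes X :: "'a set" and d :: "'a \<Rightarrow> 'a \<Rightarrow> real" and T :: "'a \<Rightarrow> 'a" and \<zeta> :: 'a
  assumes "phi_metric_space X d"
    and "T \<in> X \<rightarrow> X"
    and "\<forall>x\<in>X. \<forall>y\<in>X. x \<noteq> y \<longrightarrow> d (T x) (T y) < d x y"
    and "\<zeta> \<in> X"
    and "\<exists>x\<in>X. \<exists>r :: nat \<Rightarrow> nat. strict_mono r \<and>
           phi_converges_to X d ((\<lambda>n. (T ^^ n) x) \<circ> r) \<zeta>"
  shows "T \<zeta> = \<zeta> \<and> (\<forall>y\<in>X. T y = y \<longrightarrow> y = \<zeta>)"
proof -
  have nn: "\<forall>x\<in>X. \<forall>y\<in>X. 0 \<le> d x y"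
    using assms(1) unfolding phi_metric_space_def by (elim conjE)
  have "\<forall>x\<in>X. \<forall>y\<in>X. d x y = 0 \<longleftrightarrow> x = y"
    using assms(1) unfolding phi_metric_space_def by (elim conjE exE)
  then have zero: "\<And>x. x \<in> X \<Longrightarrow> d x x = 0" by blast
  have TX: "\<And>x. x \<in> X \<Longrightarrow> T x \<in> X" using assms(2) by auto
  \<comment> \<open>Strict contraction says nothing when \<open>x = y\<close>; there both distances
    are 0. The weak form therefore also covers an orbit that has reached a fixed point.\<close>
  have le: "\<forall>x\<in>X. \<forall>y\<in>X. d (T x) (T y) \<le> d x y"
  proof (intro ballI)
    fix x y assume "x \<in> X" "y \<in> X"
    then show "d (T x) (T y) \<le> d x y"
      using assms(3) zero TX by (cases "x = y") (simp_all add: less_imp_le)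
  qed
  obtain x r where x: "x \<in> X" and r: "strict_mono r"
    and conv: "phi_converges_to X d (\<lambda>n. (T ^^ r n) x) \<zeta>"
    using assms(5) unfolding o_def by blast
  have orbit: "(T ^^ n) x \<in> X" for n by (induction n) (auto simp: x TX)
  define a where "a n = d ((T ^^ n) x) (T ((T ^^ n) x))" for n
  have "decseq a"
    unfolding a_def by (intro decseq_SucI) (simp add: le orbit TX)
  moreover have "\<forall>n. 0 \<le> a n" using nn orbit TX by (simp add: a_def)
  ultimately obtain L where L: "a \<longlonglongrightarrow> L" by (blast elim: decseq_convergent)
  note step = nonexpansive_phi_converges_to[OF nn assms(2) le]
  have "(\<lambda>n. a (r n)) \<longlonglongrightarrow> d \<zeta> (T \<zeta>)"
    unfolding a_def by (rule phi_metric_tendsto[OF assms(1) conv step[OF conv]])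
  moreover have "(\<lambda>n. a (r n)) \<longlonglongrightarrow> L"
    using LIMSEQ_subseq_LIMSEQ[OF L r] by (simp add: o_def)
  ultimately have 1: "d \<zeta> (T \<zeta>) = L" by (rule LIMSEQ_unique)
  \<comment> \<open>The index is \<open>Suc (r n)\<close>, not \<open>r (Suc n)\<close>:
    \<open>T\<close> is applied to the terms of the subsequence, once for the first argument of
    \<open>d\<close> and twice for the second.\<close>
  have "(\<lambda>n. a (Suc (r n))) \<longlonglongrightarrow> d (T \<zeta>) (T (T \<zeta>))"
    using phi_metric_tendsto[OF assms(1) step[OF conv] step[OF step[OF conv]]]
    by (simp add: a_def)
  moreover have "(\<lambda>n. a (Suc (r n))) \<longlonglongrightarrow> L"
    using LIMSEQ_subseq_LIMSEQ[OF LIMSEQ_Suc[OF L] r] by (simp add: o_def)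
  ultimately have 2: "d (T \<zeta>) (T (T \<zeta>)) = L" by (rule LIMSEQ_unique)
  have "T \<zeta> = \<zeta>"
  proof (rule ccontr)
    assume "T \<zeta> \<noteq> \<zeta>"
    then have "d (T \<zeta>) (T (T \<zeta>)) < d \<zeta> (T \<zeta>)"
      using assms(3)[rule_format, OF assms(4) TX[OF assms(4)]] by simp
    then show False using 1 2 by simp
  qed
  \<comment> \<open>Two distinct fixed points would give
    \<open>d y \<zeta> < d y \<zeta>\<close>.\<close>
  moreover have "y = \<zeta>" if "y \<in> X" "T y = y" for y
    using assms(3)[rule_format, OF that(1) assms(4)] that(2) calculation by auto
  ultimately show ?thesis by simp
qed

end
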